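(* Let $\bar\theta\ge 0$ satisfy $\bar\theta<1/c_1$, and assume $\theta_k\le\bar\theta$ for every $k\ge 0$. Let $\sigma>0$ be such that $$\sigma<\min\left\{\delta_1,\delta_2,\frac{4\omega(1-\bar\theta c_1)}{2c_2+Lc_1^2}\right\},$$ and set $$\eta:=\bar\theta c_1+\frac{(2c_2+Lc_1^2)\sigma}{4\omega},\qquad r:=\frac{\sigma(1-\eta)}{2(1+c_1)[1-\eta+(1+\bar\theta)c_1]}.$$ Let $\{x_k\}$ be the sequence generated by the LMM-IP with starting point $x_0\in B(x_*,r)\cap C$. Then: (a) the sequence $\{\operatorname{dist}(x_k,C^* )\}$ converges to zero linearly; if, additionally, $\lim_{k\to\infty}\theta_k=0$, the convergence is superlinear; (b) the sequence $\{x_k\}$ converges to a point belonging to $C^*$.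
   Context: Setting: $C\subset\mathbb{R}^n$ is a nonempty closed convex set contained in an open set $\Omega\subset\mathbb{R}^n$, $F:\Omega\to\mathbb{R}^m$ is continuously differentiable with Jacobian $F'(x)$, and $C^*=\{x\in C: F(x)=0\}$ is assumed nonempty. $\|\cdot\|$ is the Euclidean norm (and the induced operator norm for matrices), $B(x,\rho)=\{y:\|y-x\|\le\rho\}$, and $\operatorname{dist}(x,C^* )=\inf_{y\in C^*}\|y-x\|$. Inexact projection: for $x\in\mathbb{R}^n$, $\varepsilon\ge0$, an $\varepsilon$-projection of $x$ onto $C$, denoted $P_C(x,\varepsilon)$, is any point $p\in C$ with $\langle x-p,y-p\rangle\le\varepsilon$ for all $y\in C$. Method LMM-IP: given $x_0\in C$ and $\{\theta_j\}\subset[0,\infty)$, for $k=0,1,2,\dots$: if $F(x_k)=0$, stop; otherwise set $\mu_k=\|F(x_k)\|^2$, let $d_k^U\in\mathbb{R}^n$ solve $(F'(x_k)^TF'(x_k)+\mu_kI)d_k^U=-F'(x_k)^TF(x_k)$, set $\varepsilon_k=\theta_k^2\|d_k^U\|^2$, and let $x_{k+1}=P_C(x_k+d_k^U,\varepsilon_k)$ be any $\varepsilon_k$-projection of $x_k+d_k^U$ onto $C$. It is assumed that the method does not stop, i.e. $F(x_k)\ne0$ for all $k$, so that an infinite sequence is generated. Standing assumptions: (A0) $x_*\in C^*$ is an arbitrary fixed point. (A1) There are $L,\delta_1>0$ (with $B(x_*,\delta_1)\subset\Omega$) such that $\|F'(x)-F'(y)\|\le L\|x-y\|$ for all $x,y\in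 B(x_*,\delta_1)$. (A2) There are $\omega,\delta_2>0$ (with $B(x_*,\delta_2)\subset\Omega$) such that $\omega\operatorname{dist}(x,C^* )\le\|F(x)\|$ for all $x\in B(x_*,\delta_2)$. Constants: $L_0>0$ is a constant with $\|F(x)-F(y)\|\le L_0\|x-y\|$ for all $x,y\in B(x_*,\delta_1)$; $c_1:=\sqrt{L^2/(4\omega^2)+1}$ and $c_2:=\sqrt{L^2/4+L_0^2}$. A nonnegative sequence $\{a_k\}$ converges to zero linearly if $a_k\to0$ and there is $q\in(0,1)$ with $a_{k+1}\le q\,a_k$ for all sufficiently large $k$; superlinearly if $a_k\to 0$ and $a_{k+1}/a_k\to0$. *)

theory Defs
  imports "HOL-Analysis.Analysis"
begin

definition zero_set :: "'a set \<Rightarrow> ('a \<Rightarrow> 'b::zero) \<Rightarrow> 'a set" where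
  "zero_set C F = {x \<in> C. F x = 0}"

text \<open>Inexact projections are not unique, so \<open>p = P\<^sub>C(x, \<epsilon>)\<close> is a relation.\<close>

definition is_eps_projection :: "'a::real_inner set \<Rightarrow> 'a \<Rightarrow> real \<Rightarrow> 'a \<Rightarrow> bool" where
  "is_eps_projection C x \<epsilon> p \<longleftrightarrow> p \<in> C \<and> (\<forall>y\<in>C. (x - p) \<bullet> (y - p) \<le> \<epsilon>)"

text \<open>The library norm on the matrix type is the Frobenius norm; this is the norm
  induced by the Euclidean norms.\<close>

definition matrix_opnorm :: "real ^ 'n ^ 'm \<Rightarrow> real" where
  "matrix_opnorm A = onorm (\<lambda>v. A *v v)"

definition continuously_differentiable_with ::
  "(real ^ 'n) set \<Rightarrow> (real ^ 'n \<Rightarrow> real ^ 'm) \<Rightarrow> (real ^ 'n \<Rightarrow> real ^ 'n ^ 'm) \<Rightarrow> bool" where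
  "continuously_differentiable_with \<Omega> F F' \<longleftrightarrow>
     (\<forall>x\<in>\<Omega>. (F has_derivative (\<lambda>h. F' x *v h)) (at x)) \<and> continuous_on \<Omega> F'"

definition is_LM_step :: "(real ^ 'n \<Rightarrow> real ^ 'm) \<Rightarrow> (real ^ 'n \<Rightarrow> real ^ 'n ^ 'm) \<Rightarrow>
    real ^ 'n \<Rightarrow> real ^ 'n \<Rightarrow> bool" where
  "is_LM_step F F' x d \<longleftrightarrow>
     (transpose (F' x) ** F' x + (norm (F x))\<^sup>2 *\<^sub>R mat 1) *v d = - (transpose (F' x) *v F x)"

text \<open>An infinite run of the method: the stopping test never succeeds.\<close>

definition LMM_IP_sequence :: "(real ^ 'n) set \<Rightarrow> (real ^ 'n \<Rightarrow> real ^ 'm) \<Rightarrow>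
    (real ^ 'n \<Rightarrow> real ^ 'n ^ 'm) \<Rightarrow> (nat \<Rightarrow> real) \<Rightarrow> (nat \<Rightarrow> real ^ 'n) \<Rightarrow> bool" where
  "LMM_IP_sequence C F F' \<theta> x \<longleftrightarrow> x 0 \<in> C \<and>
     (\<forall>k. F (x k) \<noteq> 0 \<and>
       (\<exists>d. is_LM_step F F' (x k) d \<and>
            is_eps_projection C (x k + d) ((\<theta> k)\<^sup>2 * (norm d)\<^sup>2) (x (Suc k))))"

definition converges_to_zero_linearly :: "(nat \<Rightarrow> real) \<Rightarrow> bool" where
  "converges_to_zero_linearly a \<longleftrightarrow> (\<forall>k. 0 \<le> a k) \<and> a \<longlonglongrightarrow> 0 \<and>
     (\<exists>q. 0 < q \<and> q < 1 \<and> (\<forall>\<^sub>F k in sequentially. a (Suc k) \<le> q * a k))"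

text \<open>Positivity is required so that the quotients are genuine, since \<open>t / 0 = 0\<close> in HOL.\<close>

definition converges_to_zero_superlinearly :: "(nat \<Rightarrow> real) \<Rightarrow> bool" where
  "converges_to_zero_superlinearly a \<longleftrightarrow> (\<forall>k. 0 < a k) \<and> a \<longlonglongrightarrow> 0 \<and>
     (\<lambda>k. a (Suc k) / a k) \<longlonglongrightarrow> 0"

end

theory Submission
  imports Defs
begin

text \<open>
  Write \<open>S\<close> for the solution set and \<open>D\<close> for the distance of the current iterate \<open>y\<close> to \<open>S\<close>.
  The unconstrained Levenberg-Marquardt direction \<open>d\<close> minimises the strictly convex function
  \<open>v \<mapsto> \<parallel>F y + F' y v\<parallel>\<^sup>2 + \<mu> \<parallel>v\<parallel>\<^sup>2\<close>. Comparing it with the competitor \<open>u\<close> that leads from \<open>y\<close> to a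
  nearest solution, whose linearised residual is of order \<open>D\<^sup>2\<close> by Taylor's formula, shows both
  \<open>\<parallel>d\<parallel> \<le> c\<^sub>1 D\<close> and \<open>\<parallel>F y + F' y d\<parallel> \<le> c\<^sub>2 D\<^sup>2\<close>
  (\<open>LM_step_minimizes\<close>, \<open>LM_step_bounds\<close>). Here the choice
  \<open>\<mu> = \<parallel>F y\<parallel>\<^sup>2\<close> matters: the error bound and the Lipschitz bound make \<open>\<mu>\<close> comparable with \<open>D\<^sup>2\<close>,
  so that both terms of the minimised function are of order \<open>D\<^sup>4\<close>. A second use of Taylor's formula
  gives \<open>\<parallel>F (y + d)\<parallel> = O(D\<^sup>2)\<close>, and the error bound converts this into \<open>dist(y + d, S) = O(D\<^sup>2)\<close>.

  Passing from \<open>y + d\<close> to an inexact projection with tolerance \<open>b\<^sup>2\<close> increases the distance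
  to a point of \<open>C\<close> by at most \<open>b\<close> (\<open>eps_projection_dist_le\<close>). Applied to a solution nearest to
  \<open>y + d\<close>, this shows that one step replaces \<open>D\<close> by at most \<open>\<theta> c\<^sub>1 D + O(D\<^sup>2)\<close>; applied to \<open>y\<close>
  itself, it shows that the step has length at most \<open>(1 + \<theta>) c\<^sub>1 D\<close> (\<open>LMM_IP_step\<close>).

  These estimates hold as long as the iterate stays within \<open>\<rho> = \<sigma> / (2 (1 + c\<^sub>1))\<close> of the reference
  solution, and there the first one gives a contraction of \<open>D\<close> by the factor \<open>\<eta> < 1\<close>. The radius
  \<open>r\<close> is chosen such that the geometric series of step lengths never leaves this ball
  (\<open>contraction_stays_in_ball\<close>). Hence the distances decay geometrically, the iterates form a
  Cauchy sequence, and the superlinear rate can be read off the estimate \<open>\<theta> c\<^sub>1 D + O(D\<^sup>2)\<close>.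
\<close>

section \<open>Inexact projections\<close>

text \<open>Expand \<open>\<parallel>p - y\<parallel>\<^sup>2\<close> around \<open>z\<close>: the defining inequality and Cauchy-Schwarz give
  \<open>t\<^sup>2 \<le> a t + b\<^sup>2\<close> with \<open>t = \<parallel>p - y\<parallel>\<close> and \<open>a = \<parallel>z - y\<parallel>\<close>, and \<open>t > a + b\<close> would contradict
  \<open>t (t - a) \<le> b\<^sup>2\<close>.\<close>

lemma eps_projection_dist_le:
  fixes p y z :: "'a::real_inner"
  assumes "is_eps_projection C z (b\<^sup>2) p" "y \<in> C" "0 \<le> b"
  shows "norm (p - y) \<le> norm (z - y) + b"
proof (rule ccontr)
  assume neg: "\<not> ?thesis"
  have "(norm (p - y))\<^sup>2 = (z - p) \<bullet> (y - p) + (z - y) \<bullet> (p - y)"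
    by (simp add: power2_norm_eq_inner inner_commute algebra_simps)
  also have "\<dots> \<le> b\<^sup>2 + norm (z - y) * norm (p - y)"
    using assms(1,2) norm_cauchy_schwarz[of "z - y" "p - y"]
    unfolding is_eps_projection_def by fastforce
  finally have "norm (p - y) * (norm (p - y) - norm (z - y)) \<le> b\<^sup>2"
    by (simp add: power2_eq_square algebra_simps)
  moreover have "b * b < norm (p - y) * (norm (p - y) - norm (z - y))"
    using neg assms(3) norm_ge_zero[of "z - y"] by (intro mult_strict_mono') linarith+
  ultimately show False by (simp add: power2_eq_square)
qed

section \<open>Taylor's formula with a Lipschitz Jacobian\<close>

lemma norm_matrix_vector_mult_le:
  fixes A :: "real ^ 'n ^ 'm"
  shows "norm (A *v v) \<le> matrix_opnorm A * norm v"
  unfolding matrix_opnorm_def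
  by (rule onorm) (rule matrix_vector_mul_bounded_linear)

text \<open>Along the segment from \<open>y\<close> to \<open>z\<close> the derivative of the linearisation error at time \<open>t\<close> is at
  most \<open>L t \<parallel>z - y\<parallel>\<^sup>2\<close>, which is the derivative of \<open>L t\<^sup>2 \<parallel>z - y\<parallel>\<^sup>2 / 2\<close>.\<close>

lemma taylor_Lipschitz_jacobian:
  fixes F :: "real ^ 'n \<Rightarrow> real ^ 'm" and F' :: "real ^ 'n \<Rightarrow> real ^ 'n ^ 'm"
  assumes "convex B" "y \<in> B" "z \<in> B"
    and der: "\<And>w. w \<in> B \<Longrightarrow> (F has_derivative (\<lambda>h. F' w *v h)) (at w)"
    and lip: "\<And>v w. v \<in> B \<Longrightarrow> w \<in> B \<Longrightarrow> matrix_opnorm (F' v - F' w) \<le> L * norm (v - w)"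
  shows "norm (F z - F y - F' y *v (z - y)) \<le> L / 2 * (norm (z - y))\<^sup>2"
proof -
  define h where "h = z - y"
  define g where "g t = F (y + t *\<^sub>R h) - t *\<^sub>R (F' y *v h)" for t
  define \<phi> where "\<phi> t = L / 2 * (norm h)\<^sup>2 * t\<^sup>2" for t
  have seg: "y + t *\<^sub>R h \<in> B" if "0 \<le> t" "t \<le> 1" for t
    using convexD_alt[OF assms(1-3) that] by (simp add: h_def algebra_simps)
  have g': "(g has_vector_derivative ((F' (y + t *\<^sub>R h) - F' y) *v h)) (at t)"
    if "0 \<le> t" "t \<le> 1" for t
  proof -
    have "((\<lambda>t. y + t *\<^sub>R h) has_vector_derivative h) (at t)"
      by (auto intro!: derivative_eq_intros)
    from vector_derivative_diff_chain_within[OF this has_derivative_at_withinI[OF der[OF seg[OF that]]]]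
    have "((\<lambda>t. F (y + t *\<^sub>R h)) has_vector_derivative (F' (y + t *\<^sub>R h) *v h)) (at t)"
      by (simp add: o_def)
    then show ?thesis
      unfolding g_def by (auto intro!: derivative_eq_intros simp: matrix_vector_mult_diff_rdistrib)
  qed
  have \<phi>': "(\<phi> has_vector_derivative (L * (norm h)\<^sup>2 * t)) (at t)" for t
    unfolding \<phi>_def has_real_derivative_iff_has_vector_derivative[symmetric]
    by (auto intro!: derivative_eq_intros)
  have "norm (g 1 - g 0) \<le> \<phi> 1 - \<phi> 0"
  proof (rule differentiable_bound_general[where f' = "\<lambda>t. (F' (y + t *\<^sub>R h) - F' y) *v h"
        and \<phi>' = "\<lambda>t. L * (norm h)\<^sup>2 * t"])
    show "continuous_on {0..1} g"
      by (intro continuous_at_imp_continuous_on ballI has_vector_derivative_continuous[OF g']) auto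
    show "continuous_on {0..1} \<phi>"
      unfolding \<phi>_def by (intro continuous_intros)
    fix t :: real assume t: "0 < t" "t < 1"
    have "norm ((F' (y + t *\<^sub>R h) - F' y) *v h) \<le> matrix_opnorm (F' (y + t *\<^sub>R h) - F' y) * norm h"
      by (rule norm_matrix_vector_mult_le)
    also have "\<dots> \<le> (L * norm (t *\<^sub>R h)) * norm h"
      using lip[OF seg[of t] assms(2)] t by (intro mult_right_mono) auto
    finally show "norm ((F' (y + t *\<^sub>R h) - F' y) *v h) \<le> L * (norm h)\<^sup>2 * t"
      using t by (simp add: power2_eq_square mult_ac)
  qed (use g' \<phi>' in auto)
  then show ?thesis by (simp add: g_def \<phi>_def h_def algebra_simps)
qed

section \<open>The Levenberg-Marquardt direction\<close>

text \<open>The defining linear system states that the gradient of the regularised least squares function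
  vanishes at \<open>d\<close>, so the difference of its values at \<open>v\<close> and \<open>d\<close> is the purely quadratic term
  \<open>\<parallel>F' y (v - d)\<parallel>\<^sup>2 + \<mu> \<parallel>v - d\<parallel>\<^sup>2\<close>.\<close>

lemma LM_step_minimizes:
  fixes F :: "real ^ 'n \<Rightarrow> real ^ 'm"
  assumes "is_LM_step F F' y d"
  shows "(norm (F y + F' y *v d))\<^sup>2 + (norm (F y))\<^sup>2 * (norm d)\<^sup>2
       \<le> (norm (F y + F' y *v v))\<^sup>2 + (norm (F y))\<^sup>2 * (norm v)\<^sup>2"
proof -
  define J \<mu> e where "J = F' y" and "\<mu> = (norm (F y))\<^sup>2" and "e = v - d"
  have "transpose J *v (F y + J *v d) + \<mu> *\<^sub>R d = 0"
    using assms unfolding is_LM_step_def J_def \<mu>_def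
    by (simp add: matrix_vector_mult_add_rdistrib matrix_vector_mul_assoc[symmetric]
        scaleR_matrix_vector_assoc[symmetric] matrix_vector_right_distrib add.assoc)
  then have "(transpose J *v (F y + J *v d) + \<mu> *\<^sub>R d) \<bullet> e = 0"
    by simp
  then have "(F y + J *v d) \<bullet> (J *v e) + \<mu> * (d \<bullet> e) = 0"
    by (simp add: inner_add_left dot_lmul_matrix transpose_matrix_vector)
  moreover have "F y + J *v v = (F y + J *v d) + J *v e" "v = d + e"
    by (simp_all add: e_def matrix_vector_mult_diff_distrib)
  then have "(norm (F y + J *v v))\<^sup>2 + \<mu> * (norm v)\<^sup>2
      = (norm (F y + J *v d))\<^sup>2 + \<mu> * (norm d)\<^sup>2 + ((norm (J *v e))\<^sup>2 + \<mu> * (norm e)\<^sup>2)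
        + 2 * ((F y + J *v d) \<bullet> (J *v e) + \<mu> * (d \<bullet> e))"
    unfolding power2_norm_eq_inner
    by (simp only: inner_add_left inner_add_right) (simp add: inner_commute algebra_simps)
  ultimately show ?thesis
    unfolding J_def[symmetric] \<mu>_def[symmetric] by (simp add: \<mu>_def)
qed

text \<open>The competitor \<open>u\<close> has value at most \<open>L\<^sup>2 D\<^sup>4 / 4 + \<mu> D\<^sup>2\<close>. Dividing by \<open>\<mu> \<ge> \<omega>\<^sup>2 D\<^sup>2\<close> bounds the
  length of \<open>d\<close>, and inserting \<open>\<mu> \<le> L\<^sub>0\<^sup>2 D\<^sup>2\<close> bounds its linearised residual.\<close>

lemma LM_step_bounds:
  fixes F :: "real ^ 'n \<Rightarrow> real ^ 'm"
  assumes step: "is_LM_step F F' y d" and "F y \<noteq> 0" "0 < \<omega>"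
    and u: "norm u = D" "norm (F y + F' y *v u) \<le> L / 2 * D\<^sup>2"
    and lower: "\<omega> * D \<le> norm (F y)" and upper: "norm (F y) \<le> L\<^sub>0 * D"
  shows "norm d \<le> sqrt (L\<^sup>2 / (4 * \<omega>\<^sup>2) + 1) * D"
    and "norm (F y + F' y *v d) \<le> sqrt (L\<^sup>2 / 4 + L\<^sub>0\<^sup>2) * D\<^sup>2"
proof -
  define \<mu> where "\<mu> = (norm (F y))\<^sup>2"
  have "0 \<le> D" using u(1) by auto
  have "0 < \<mu>" using assms(2) by (simp add: \<mu>_def)
  have \<mu>_lower: "\<omega>\<^sup>2 * D\<^sup>2 \<le> \<mu>"
    using power_mono[OF lower, of 2] \<open>0 \<le> D\<close> \<open>0 < \<omega>\<close> by (simp add: \<mu>_def power_mult_distrib)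
  have \<mu>_upper: "\<mu> \<le> L\<^sub>0\<^sup>2 * D\<^sup>2"
    using power_mono[OF upper, of 2] by (simp add: \<mu>_def power_mult_distrib)
  have "(norm (F y + F' y *v u))\<^sup>2 \<le> (L / 2 * D\<^sup>2)\<^sup>2"
    by (rule power_mono[OF u(2)]) simp
  then have val: "(norm (F y + F' y *v d))\<^sup>2 + \<mu> * (norm d)\<^sup>2 \<le> L\<^sup>2 / 4 * (D\<^sup>2 * D\<^sup>2) + \<mu> * D\<^sup>2"
    using LM_step_minimizes[OF step, of u] u(1)
    by (simp add: \<mu>_def power_mult_distrib power_divide power2_eq_square mult_ac)
  have "L\<^sup>2 / 4 * (D\<^sup>2 * D\<^sup>2) = L\<^sup>2 / (4 * \<omega>\<^sup>2) * D\<^sup>2 * (\<omega>\<^sup>2 * D\<^sup>2)"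
    using \<open>0 < \<omega>\<close> by (simp add: field_simps)
  also have "\<dots> \<le> L\<^sup>2 / (4 * \<omega>\<^sup>2) * D\<^sup>2 * \<mu>"
    using \<mu>_lower by (intro mult_left_mono) auto
  finally have "\<mu> * (norm d)\<^sup>2 \<le> \<mu> * ((L\<^sup>2 / (4 * \<omega>\<^sup>2) + 1) * D\<^sup>2)"
    using val zero_le_power2[of "norm (F y + F' y *v d)"] unfolding distrib_right distrib_left
    by (simp only: mult_1 mult.commute mult.left_commute)
  then have "(norm d)\<^sup>2 \<le> (L\<^sup>2 / (4 * \<omega>\<^sup>2) + 1) * D\<^sup>2"
    using \<open>0 < \<mu>\<close> by simp
  then have "norm d \<le> sqrt ((L\<^sup>2 / (4 * \<omega>\<^sup>2) + 1) * D\<^sup>2)"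
    by (rule real_le_rsqrt)
  then show "norm d \<le> sqrt (L\<^sup>2 / (4 * \<omega>\<^sup>2) + 1) * D"
    using \<open>0 \<le> D\<close> by (simp only: real_sqrt_mult real_sqrt_abs abs_of_nonneg)
  have "\<mu> * D\<^sup>2 \<le> L\<^sub>0\<^sup>2 * D\<^sup>2 * D\<^sup>2"
    using \<mu>_upper by (rule mult_right_mono) simp
  moreover have "0 \<le> \<mu> * (norm d)\<^sup>2" using \<open>0 < \<mu>\<close> by simp
  ultimately have "(norm (F y + F' y *v d))\<^sup>2 \<le> (L\<^sup>2 / 4 + L\<^sub>0\<^sup>2) * (D\<^sup>2)\<^sup>2"
    using val by (simp add: power2_eq_square[of "D\<^sup>2"] algebra_simps)
  then have "norm (F y + F' y *v d) \<le> sqrt ((L\<^sup>2 / 4 + L\<^sub>0\<^sup>2) * (D\<^sup>2)\<^sup>2)"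
    by (rule real_le_rsqrt)
  then show "norm (F y + F' y *v d) \<le> sqrt (L\<^sup>2 / 4 + L\<^sub>0\<^sup>2) * D\<^sup>2"
    by (simp only: real_sqrt_mult real_sqrt_abs abs_of_nonneg zero_le_power2)
qed

section \<open>One step of the method\<close>

text \<open>The ball of radius \<open>\<sigma>\<close> must contain a solution nearest to \<open>y\<close> as well as the trial point
  \<open>y + d\<close>. Since \<open>D \<le> \<parallel>y - xs\<parallel>\<close>, these lie within \<open>2 \<parallel>y - xs\<parallel>\<close> and \<open>(1 + c\<^sub>1) \<parallel>y - xs\<parallel>\<close> of \<open>xs\<close>, and
  \<open>c\<^sub>1 \<ge> 1\<close>; this is what the bound on \<open>\<parallel>y - xs\<parallel>\<close> is for.\<close>

lemma LMM_IP_step: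
  fixes C :: "(real ^ 'n) set" and F :: "real ^ 'n \<Rightarrow> real ^ 'm" and F' :: "real ^ 'n \<Rightarrow> real ^ 'n ^ 'm"
  defines "S \<equiv> zero_set C F"
  assumes "closed S" "xs \<in> S" "0 < \<omega>" "0 < L"
    and der: "\<And>w. w \<in> cball xs \<sigma> \<Longrightarrow> (F has_derivative (\<lambda>h. F' w *v h)) (at w)"
    and lip: "\<And>v w. v \<in> cball xs \<sigma> \<Longrightarrow> w \<in> cball xs \<sigma> \<Longrightarrow>
        matrix_opnorm (F' v - F' w) \<le> L * norm (v - w)"
    and eb: "\<And>w. w \<in> cball xs \<sigma> \<Longrightarrow> \<omega> * infdist w S \<le> norm (F w)"
    and lipF: "\<And>v w. v \<in> cball xs \<sigma> \<Longrightarrow> w \<in> cball xs \<sigma> \<Longrightarrow>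
        norm (F v - F w) \<le> L\<^sub>0 * norm (v - w)"
    and c1: "c\<^sub>1 = sqrt (L\<^sup>2 / (4 * \<omega>\<^sup>2) + 1)"
    and c2: "c\<^sub>2 = sqrt (L\<^sup>2 / 4 + L\<^sub>0\<^sup>2)"
    and y: "y \<in> C" "F y \<noteq> 0" "(1 + c\<^sub>1) * norm (y - xs) \<le> \<sigma>"
    and step: "is_LM_step F F' y d"
    and proj: "is_eps_projection C (y + d) (\<theta>\<^sup>2 * (norm d)\<^sup>2) p" and "0 \<le> \<theta>"
  shows "infdist p S \<le> (2 * c\<^sub>2 + L * c\<^sub>1\<^sup>2) / (2 * \<omega>) * (infdist y S)\<^sup>2 + \<theta> * c\<^sub>1 * infdist y S"
    and "norm (p - y) \<le> (1 + \<theta>) * c\<^sub>1 * infdist y S"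
proof -
  define D where "D = infdist y S"
  have "S \<noteq> {}" using \<open>xs \<in> S\<close> by auto
  have "0 \<le> D" by (simp add: D_def infdist_nonneg)
  have "D \<le> norm (y - xs)"
    using infdist_le[OF \<open>xs \<in> S\<close>, of y] by (simp add: D_def dist_norm)
  have "1 \<le> c\<^sub>1" by (simp add: c1)
  then have two: "2 * norm (y - xs) \<le> \<sigma>"
    using y(3) mult_right_mono[of 2 "1 + c\<^sub>1" "norm (y - xs)"] by simp
  then have "norm (y - xs) \<le> \<sigma>" using norm_ge_zero[of "y - xs"] by linarith
  then have yB: "y \<in> cball xs \<sigma>" by (simp add: dist_norm norm_minus_commute)
  obtain s where s: "s \<in> S" "D = dist y s"
    using infdist_attains_inf[OF \<open>closed S\<close> \<open>S \<noteq> {}\<close>] unfolding D_def by metis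
  have sB: "s \<in> cball xs \<sigma>"
    using dist_triangle[of xs s y] s(2) \<open>D \<le> norm (y - xs)\<close> two
    by (simp add: dist_norm norm_minus_commute)
  have Fs: "F s = 0" using s(1) by (simp add: S_def zero_set_def)
  have Ds: "norm (s - y) = D" using s(2) by (simp add: dist_norm norm_minus_commute)
  have upper: "norm (F y) \<le> L\<^sub>0 * D"
    using lipF[OF yB sB] Fs Ds by (simp add: norm_minus_commute)
  have res: "norm (F y + F' y *v (s - y)) \<le> L / 2 * D\<^sup>2"
  proof -
    have "norm (F s - F y - F' y *v (s - y)) \<le> L / 2 * (norm (s - y))\<^sup>2"
      using yB sB der lip by (intro taylor_Lipschitz_jacobian[of "cball xs \<sigma>"]) auto
    moreover have "F s - F y - F' y *v (s - y) = - (F y + F' y *v (s - y))"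
      by (simp add: Fs)
    ultimately show ?thesis by (simp only: norm_minus_cancel Ds)
  qed
  note bounds = LM_step_bounds[OF step y(2) \<open>0 < \<omega>\<close> Ds res eb[OF yB, folded D_def] upper,
      folded c1 c2]
  have dB: "y + d \<in> cball xs \<sigma>"
  proof -
    have "norm (y + d - xs) \<le> norm (y - xs) + norm d"
      using norm_triangle_ineq[of "y - xs" d] by (simp add: algebra_simps)
    also have "\<dots> \<le> norm (y - xs) + c\<^sub>1 * norm (y - xs)"
      using order_trans[OF bounds(1) mult_left_mono[OF \<open>D \<le> norm (y - xs)\<close>]] \<open>1 \<le> c\<^sub>1\<close> by simp
    also have "\<dots> \<le> \<sigma>" using y(3) by (simp add: algebra_simps)
    finally show ?thesis by (simp add: dist_norm norm_minus_commute)
  qed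
  have trial: "norm (F (y + d)) \<le> (c\<^sub>2 + L / 2 * c\<^sub>1\<^sup>2) * D\<^sup>2"
  proof -
    have "norm (F (y + d) - F y - F' y *v (y + d - y)) \<le> L / 2 * (norm (y + d - y))\<^sup>2"
      using yB dB der lip by (intro taylor_Lipschitz_jacobian[of "cball xs \<sigma>"]) auto
    then have "norm (F (y + d) - (F y + F' y *v d)) \<le> L / 2 * (norm d)\<^sup>2"
      by (simp add: algebra_simps)
    also have "\<dots> \<le> L / 2 * (c\<^sub>1 * D)\<^sup>2"
      using bounds(1) \<open>0 < L\<close> by (intro mult_left_mono power_mono) auto
    finally show ?thesis
      using bounds(2) norm_triangle_sub[of "F (y + d)" "F y + F' y *v d"]
      by (simp add: power_mult_distrib algebra_simps)
  qed
  obtain s' where s': "s' \<in> S" "infdist (y + d) S = dist (y + d) s'"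
    using infdist_attains_inf[OF \<open>closed S\<close> \<open>S \<noteq> {}\<close>] by metis
  have near: "dist (y + d) s' \<le> (2 * c\<^sub>2 + L * c\<^sub>1\<^sup>2) / (2 * \<omega>) * D\<^sup>2"
    using eb[OF dB] trial \<open>0 < \<omega>\<close> s'(2) by (simp add: field_simps)
  have proj': "is_eps_projection C (y + d) ((\<theta> * norm d)\<^sup>2) p"
    using proj by (simp add: power_mult_distrib)
  have \<theta>d: "0 \<le> \<theta> * norm d" "\<theta> * norm d \<le> \<theta> * c\<^sub>1 * D"
    using \<open>0 \<le> \<theta>\<close> bounds(1) mult_left_mono[OF bounds(1) \<open>0 \<le> \<theta>\<close>] by (auto simp: mult_ac)
  have "infdist p S \<le> norm (p - s')"
    using infdist_le[OF s'(1), of p] by (simp add: dist_norm)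
  also have "\<dots> \<le> dist (y + d) s' + \<theta> * norm d"
    unfolding dist_norm using s'(1) \<theta>d
    by (intro eps_projection_dist_le[OF proj']) (auto simp: S_def zero_set_def)
  finally show "infdist p S \<le> (2 * c\<^sub>2 + L * c\<^sub>1\<^sup>2) / (2 * \<omega>) * (infdist y S)\<^sup>2 + \<theta> * c\<^sub>1 * infdist y S"
    using near \<theta>d(2) unfolding D_def by linarith
  have "norm (p - y) \<le> norm d + \<theta> * norm d"
    using eps_projection_dist_le[OF proj' y(1) \<theta>d(1)] by simp
  then show "norm (p - y) \<le> (1 + \<theta>) * c\<^sub>1 * infdist y S"
    using bounds(1) \<theta>d(2) unfolding D_def by (simp add: algebra_simps)
qed

section \<open>Iterating a local contraction of the distance to a set\<close>

text \<open>As long as the iterates stay in the ball, their steps are dominated by a geometric series with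
  ratio \<open>\<eta>\<close>, so the total displacement is at most \<open>K r / (1 - \<eta>)\<close>. The induction carries the
  exact partial sums of this series.\<close>

lemma contraction_stays_in_ball:
  fixes x :: "nat \<Rightarrow> 'a::metric_space"
  assumes "0 \<le> \<eta>" "\<eta> < 1" "0 \<le> K" "z \<in> S" "dist (x 0) z \<le> r" "r + K * r / (1 - \<eta>) \<le> \<rho>"
    and contr: "\<And>k. dist (x k) z \<le> \<rho> \<Longrightarrow> infdist (x (Suc k)) S \<le> \<eta> * infdist (x k) S"
    and len: "\<And>k. dist (x k) z \<le> \<rho> \<Longrightarrow> dist (x (Suc k)) (x k) \<le> K * infdist (x k) S"
  shows "dist (x k) z \<le> \<rho>" and "infdist (x k) S \<le> \<eta> ^ k * r"
proof -
  have "0 \<le> r" using assms(5) zero_le_dist order_trans by blast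
  have inball: "d \<le> \<rho>" if "d \<le> r + K * r * ((1 - \<eta> ^ n) / (1 - \<eta>))" for d n
  proof -
    have "K * r * ((1 - \<eta> ^ n) / (1 - \<eta>)) \<le> K * r * (1 / (1 - \<eta>))"
      using assms(1-3) \<open>0 \<le> r\<close> by (intro mult_left_mono divide_right_mono) auto
    then show ?thesis using that assms(6) by simp
  qed
  have "dist (x k) z \<le> r + K * r * ((1 - \<eta> ^ k) / (1 - \<eta>)) \<and> infdist (x k) S \<le> \<eta> ^ k * r"
  proof (induction k)
    case 0
    then show ?case using assms(5) infdist_le[OF assms(4), of "x 0"] by simp
  next
    case (Suc k)
    then have "dist (x k) z \<le> \<rho>" using inball by blast
    note * = contr[OF this] len[OF this]
    have "infdist (x (Suc k)) S \<le> \<eta> ^ Suc k * r"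
      using *(1) mult_left_mono[OF conjunct2[OF Suc] \<open>0 \<le> \<eta>\<close>] by (simp add: mult_ac)
    moreover have "dist (x (Suc k)) z \<le> r + K * r * ((1 - \<eta> ^ Suc k) / (1 - \<eta>))"
    proof -
      have "dist (x (Suc k)) (x k) \<le> K * r * \<eta> ^ k"
        using *(2) mult_left_mono[OF conjunct2[OF Suc] \<open>0 \<le> K\<close>] by (simp add: mult_ac)
      then have "dist (x (Suc k)) z \<le> r + K * r * ((1 - \<eta> ^ k) / (1 - \<eta>) + \<eta> ^ k)"
        using dist_triangle[of "x (Suc k)" z "x k"] Suc unfolding distrib_left by linarith
      moreover have "(1 - \<eta> ^ k) / (1 - \<eta>) + \<eta> ^ k = (1 - \<eta> ^ Suc k) / (1 - \<eta>)"
        using assms(2) by (simp add: field_simps)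
      ultimately show ?thesis by simp
    qed
    ultimately show ?case by blast
  qed
  then show "dist (x k) z \<le> \<rho>" "infdist (x k) S \<le> \<eta> ^ k * r"
    using inball by blast+
qed

lemma convergent_geometric_steps:
  fixes x :: "nat \<Rightarrow> 'a::banach"
  assumes "0 \<le> \<eta>" "\<eta> < 1" "\<And>k. dist (x (Suc k)) (x k) \<le> M * \<eta> ^ k"
  shows "convergent x"
proof -
  have "summable (\<lambda>k. M * \<eta> ^ k)"
    using assms(1,2) by (intro summable_mult summable_geometric) simp
  then have "summable (\<lambda>k. x (Suc k) - x k)"
    by (rule summable_comparison_test'[where N = 0]) (use assms(3) in \<open>simp add: dist_norm\<close>)
  then have "(\<lambda>n. x 0 + (\<Sum>k<n. x (Suc k) - x k)) \<longlonglongrightarrow> x 0 + (\<Sum>k. x (Suc k) - x k)"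
    by (intro tendsto_intros summable_LIMSEQ)
  then show ?thesis
    unfolding sum_lessThan_telescope by (auto simp: convergent_def)
qed

section \<open>Convergence of the method\<close>

theorem theorem7:
  fixes C \<Omega> :: "(real ^ 'n) set"
    and F :: "real ^ 'n \<Rightarrow> real ^ 'm"
    and F' :: "real ^ 'n \<Rightarrow> real ^ 'n ^ 'm"
    and xs :: "real ^ 'n"
    and x :: "nat \<Rightarrow> real ^ 'n"
    and \<theta> :: "nat \<Rightarrow> real"
    and L L\<^sub>0 \<omega> \<delta>\<^sub>1 \<delta>\<^sub>2 c\<^sub>1 c\<^sub>2 \<theta>bar \<sigma> \<eta> r :: real
  assumes "C \<noteq> {}" "closed C" "convex C" "open \<Omega>" "C \<subseteq> \<Omega>"
    and "continuously_differentiable_with \<Omega> F F'"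
    and A0: "xs \<in> zero_set C F"
    and A1: "L > 0" "\<delta>\<^sub>1 > 0" "cball xs \<delta>\<^sub>1 \<subseteq> \<Omega>"
      "\<And>y z. y \<in> cball xs \<delta>\<^sub>1 \<Longrightarrow> z \<in> cball xs \<delta>\<^sub>1 \<Longrightarrow>
         matrix_opnorm (F' y - F' z) \<le> L * norm (y - z)"
    and A2: "\<omega> > 0" "\<delta>\<^sub>2 > 0" "cball xs \<delta>\<^sub>2 \<subseteq> \<Omega>"
      "\<And>y. y \<in> cball xs \<delta>\<^sub>2 \<Longrightarrow> \<omega> * infdist y (zero_set C F) \<le> norm (F y)"
    and L0: "L\<^sub>0 > 0"
      "\<And>y z. y \<in> cball xs \<delta>\<^sub>1 \<Longrightarrow> z \<in> cball xs \<delta>\<^sub>1 \<Longrightarrow>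
         norm (F y - F z) \<le> L\<^sub>0 * norm (y - z)"
    and c1: "c\<^sub>1 = sqrt (L\<^sup>2 / (4 * \<omega>\<^sup>2) + 1)"
    and c2: "c\<^sub>2 = sqrt (L\<^sup>2 / 4 + L\<^sub>0\<^sup>2)"
    and theta: "0 \<le> \<theta>bar" "\<theta>bar < 1 / c\<^sub>1" "\<And>k. 0 \<le> \<theta> k" "\<And>k. \<theta> k \<le> \<theta>bar"
    and sigma: "0 < \<sigma>"
      "\<sigma> < Min {\<delta>\<^sub>1, \<delta>\<^sub>2, 4 * \<omega> * (1 - \<theta>bar * c\<^sub>1) / (2 * c\<^sub>2 + L * c\<^sub>1\<^sup>2)}"
    and eta: "\<eta> = \<theta>bar * c\<^sub>1 + (2 * c\<^sub>2 + L * c\<^sub>1\<^sup>2) * \<sigma> / (4 * \<omega>)"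
    and r: "r = \<sigma> * (1 - \<eta>) / (2 * (1 + c\<^sub>1) * (1 - \<eta> + (1 + \<theta>bar) * c\<^sub>1))"
    and run: "LMM_IP_sequence C F F' \<theta> x" "x 0 \<in> cball xs r \<inter> C"
  shows "converges_to_zero_linearly (\<lambda>k. infdist (x k) (zero_set C F))
       \<and> (\<theta> \<longlonglongrightarrow> 0 \<longrightarrow>
            converges_to_zero_superlinearly (\<lambda>k. infdist (x k) (zero_set C F)))
       \<and> (\<exists>xlim \<in> zero_set C F. x \<longlonglongrightarrow> xlim)"
proof -
  define S where "S = zero_set C F"
  define D where "D k = infdist (x k) S" for k
  define K where "K = (1 + \<theta>bar) * c\<^sub>1"
  define A where "A = 2 * c\<^sub>2 + L * c\<^sub>1\<^sup>2"
  \<comment> \<open>The radius in which the one-step estimates apply; the factor 2 gives \<open>D k \<le> \<sigma> / 2\<close>,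
    which turns the quadratic term \<open>A / (2 * \<omega>) * (D k)\<^sup>2\<close> into the summand
    \<open>A * \<sigma> / (4 * \<omega>)\<close> of \<open>\<eta>\<close> times \<open>D k\<close>.\<close>
  define \<rho> where "\<rho> = \<sigma> / (2 * (1 + c\<^sub>1))"
  have der: "(F has_derivative (\<lambda>h. F' w *v h)) (at w)" if "w \<in> \<Omega>" for w
    using assms(6) that by (simp add: continuously_differentiable_with_def)
  have "xs \<in> S" using A0 by (simp add: S_def)
  have "closed S"
  proof -
    have "continuous_on C F"
      using \<open>C \<subseteq> \<Omega>\<close>
      by (intro continuous_at_imp_continuous_on ballI has_derivative_continuous[OF der]) auto
    then have "closed (C \<inter> F -` {0})"
      using \<open>closed C\<close> by (intro continuous_closed_preimage) auto
    moreover have "C \<inter> F -` {0} = S" by (auto simp: S_def zero_set_def)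
    ultimately show ?thesis by simp
  qed
  have "1 \<le> c\<^sub>1" by (simp add: c1)
  have "0 < c\<^sub>2" using \<open>0 < L\<^sub>0\<close> by (simp add: c2 add_nonneg_pos)
  then have "0 < A" using \<open>0 < L\<close> by (simp add: A_def add_pos_nonneg)
  have \<sigma>: "\<sigma> < \<delta>\<^sub>1" "\<sigma> < \<delta>\<^sub>2" "\<sigma> < 4 * \<omega> * (1 - \<theta>bar * c\<^sub>1) / A"
    using sigma(2) by (simp_all add: A_def)
  then have "A * \<sigma> / (4 * \<omega>) < 1 - \<theta>bar * c\<^sub>1"
    using \<open>0 < A\<close> \<open>0 < \<omega>\<close> by (simp add: field_simps)
  then have "\<eta> < 1" by (simp add: eta A_def)
  have "0 < A * \<sigma> / (4 * \<omega>)"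
    using \<open>0 < A\<close> \<open>0 < \<sigma>\<close> \<open>0 < \<omega>\<close> by simp
  then have "0 < \<eta>"
    using \<open>0 \<le> \<theta>bar\<close> \<open>1 \<le> c\<^sub>1\<close> unfolding eta A_def[symmetric] by (intro add_nonneg_pos) auto
  have "0 \<le> K" using \<open>0 \<le> \<theta>bar\<close> \<open>1 \<le> c\<^sub>1\<close> by (simp add: K_def)
  have "0 < \<rho>" "\<rho> \<le> \<sigma>" "(1 + c\<^sub>1) * \<rho> \<le> \<sigma>" "\<rho> \<le> \<sigma> / 2"
    using \<open>0 < \<sigma>\<close> \<open>1 \<le> c\<^sub>1\<close> by (simp_all add: \<rho>_def field_simps)
  have xC: "x k \<in> C" for k
    using run(1) unfolding LMM_IP_sequence_def is_eps_projection_def by (cases k) auto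
  have xF: "F (x k) \<noteq> 0" for k
    using run(1) unfolding LMM_IP_sequence_def by auto
  have step: "D (Suc k) \<le> A / (2 * \<omega>) * (D k)\<^sup>2 + \<theta> k * c\<^sub>1 * D k"
      "dist (x (Suc k)) (x k) \<le> (1 + \<theta> k) * c\<^sub>1 * D k"
    if "dist (x k) xs \<le> \<rho>" for k
  proof -
    obtain d where d: "is_LM_step F F' (x k) d"
        "is_eps_projection C (x k + d) ((\<theta> k)\<^sup>2 * (norm d)\<^sup>2) (x (Suc k))"
      using run(1) unfolding LMM_IP_sequence_def by auto
    have "(1 + c\<^sub>1) * norm (x k - xs) \<le> (1 + c\<^sub>1) * \<rho>"
      using that \<open>1 \<le> c\<^sub>1\<close> by (intro mult_left_mono) (auto simp: dist_norm)
    then have near: "(1 + c\<^sub>1) * norm (x k - xs) \<le> \<sigma>"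
      using \<open>(1 + c\<^sub>1) * \<rho> \<le> \<sigma>\<close> by linarith
    have sub: "cball xs \<sigma> \<subseteq> cball xs \<delta>\<^sub>1" "cball xs \<sigma> \<subseteq> cball xs \<delta>\<^sub>2"
      using \<sigma> by auto
    note one = LMM_IP_step[of C F xs \<omega> L \<sigma> F', folded S_def,
        OF \<open>closed S\<close> \<open>xs \<in> S\<close> \<open>0 < \<omega>\<close> \<open>0 < L\<close> der A1(4) A2(4)[folded S_def] L0(2) c1 c2
           xC xF near d theta(3)]
    show "D (Suc k) \<le> A / (2 * \<omega>) * (D k)\<^sup>2 + \<theta> k * c\<^sub>1 * D k"
      unfolding D_def A_def by (rule one(1)) (use sub A1(3) in blast)+
    show "dist (x (Suc k)) (x k) \<le> (1 + \<theta> k) * c\<^sub>1 * D k"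
      unfolding D_def dist_norm by (rule one(2)) (use sub A1(3) in blast)+
  qed
  have D_nonneg: "0 \<le> D k" for k by (simp add: D_def infdist_nonneg)
  have contr: "D (Suc k) \<le> \<eta> * D k" if k: "dist (x k) xs \<le> \<rho>" for k
  proof -
    have "D k \<le> \<sigma> / 2"
      using infdist_le[OF \<open>xs \<in> S\<close>, of "x k"] k \<open>\<rho> \<le> \<sigma> / 2\<close> by (simp add: D_def)
    then have "A / (2 * \<omega>) * (D k * D k) \<le> A / (2 * \<omega>) * (\<sigma> / 2 * D k)"
      using \<open>0 < A\<close> \<open>0 < \<omega>\<close> D_nonneg by (intro mult_left_mono mult_right_mono) auto
    moreover have "\<theta> k * c\<^sub>1 * D k \<le> \<theta>bar * c\<^sub>1 * D k"
      using theta(4) \<open>1 \<le> c\<^sub>1\<close> D_nonneg by (intro mult_right_mono) auto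
    ultimately show ?thesis
      using step(1)[OF k] unfolding eta A_def[symmetric]
      by (simp add: power2_eq_square algebra_simps)
  qed
  have len: "dist (x (Suc k)) (x k) \<le> K * D k" if k: "dist (x k) xs \<le> \<rho>" for k
  proof -
    have "(1 + \<theta> k) * c\<^sub>1 * D k \<le> (1 + \<theta>bar) * c\<^sub>1 * D k"
      using theta(4) \<open>1 \<le> c\<^sub>1\<close> D_nonneg by (intro mult_right_mono) auto
    then show ?thesis using step(2)[OF k] by (simp add: K_def)
  qed
  have "r + K * r / (1 - \<eta>) = r * (1 - \<eta> + K) / (1 - \<eta>)"
    using \<open>\<eta> < 1\<close> by (simp add: field_simps)
  also have "\<dots> = \<rho>"
    using \<open>\<eta> < 1\<close> \<open>0 \<le> K\<close> \<open>1 \<le> c\<^sub>1\<close> unfolding r \<rho>_def K_def[symmetric] by (simp add: divide_simps)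
  finally have radius: "r + K * r / (1 - \<eta>) \<le> \<rho>" by simp
  have start: "dist (x 0) xs \<le> r"
    using run(2) by (simp add: dist_commute)
  note stays = contraction_stays_in_ball[of \<eta> K xs S x r \<rho>, folded D_def,
      OF less_imp_le[OF \<open>0 < \<eta>\<close>] \<open>\<eta> < 1\<close> \<open>0 \<le> K\<close> \<open>xs \<in> S\<close> start radius contr len]
  have in_ball: "dist (x k) xs \<le> \<rho>" for k by (rule stays(1))
  have geo: "D k \<le> \<eta> ^ k * r" for k by (rule stays(2))
  have D_lim: "D \<longlonglongrightarrow> 0"
  proof (rule tendsto_sandwich[where f = "\<lambda>_. 0"])
    show "(\<lambda>k. \<eta> ^ k * r) \<longlonglongrightarrow> 0"
      using \<open>0 < \<eta>\<close> \<open>\<eta> < 1\<close> by (intro tendsto_mult_left_zero LIMSEQ_realpow_zero) auto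
  qed (use geo D_nonneg in auto)
  have linear: "converges_to_zero_linearly D"
    unfolding converges_to_zero_linearly_def
    using D_nonneg D_lim \<open>0 < \<eta>\<close> \<open>\<eta> < 1\<close> contr[OF in_ball] by auto
  have superlinear: "converges_to_zero_superlinearly D" if "\<theta> \<longlonglongrightarrow> 0"
  proof -
    have D_pos: "0 < D k" for k
      unfolding D_def using xF[of k] \<open>closed S\<close> \<open>xs \<in> S\<close>
      by (intro infdist_pos_not_in_closed) (auto simp: S_def zero_set_def)
    have "(\<lambda>k. D (Suc k) / D k) \<longlonglongrightarrow> 0"
    proof (rule tendsto_sandwich[where f = "\<lambda>_. 0"])
      have "(\<lambda>k. A / (2 * \<omega>) * D k + \<theta> k * c\<^sub>1) \<longlonglongrightarrow> A / (2 * \<omega>) * 0 + 0 * c\<^sub>1"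
        using D_lim that by (intro tendsto_intros)
      then show "(\<lambda>k. A / (2 * \<omega>) * D k + \<theta> k * c\<^sub>1) \<longlonglongrightarrow> 0" by simp
      have "D (Suc k) / D k \<le> A / (2 * \<omega>) * D k + \<theta> k * c\<^sub>1" for k
        using step(1)[OF in_ball[of k]] D_pos[of k]
        by (simp only: pos_divide_le_eq power2_eq_square distrib_right mult.assoc)
      then show "\<forall>\<^sub>F k in sequentially. D (Suc k) / D k \<le> A / (2 * \<omega>) * D k + \<theta> k * c\<^sub>1"
        by simp
    qed (use D_nonneg in auto)
    then show ?thesis
      unfolding converges_to_zero_superlinearly_def using D_pos D_lim by blast
  qed
  have "dist (x (Suc k)) (x k) \<le> K * r * \<eta> ^ k" for k
    using len[OF in_ball[of k]] mult_left_mono[OF geo[of k] \<open>0 \<le> K\<close>] by (simp add: mult_ac)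
  then have "convergent x"
    using \<open>0 < \<eta>\<close> \<open>\<eta> < 1\<close> by (intro convergent_geometric_steps[of \<eta>]) auto
  then obtain l where l: "x \<longlonglongrightarrow> l" by (auto simp: convergent_def)
  have "D \<longlonglongrightarrow> infdist l S"
    unfolding D_def using l by (rule tendsto_infdist)
  then have "infdist l S = 0"
    using D_lim LIMSEQ_unique by blast
  then have "l \<in> S"
    using \<open>closed S\<close> \<open>xs \<in> S\<close> in_closed_iff_infdist_zero by blast
  then show ?thesis
    using linear superlinear l unfolding D_def S_def by blast
qed

end
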